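(* Let $(X,d)$ be a metric space, $Y$ a topological space, $\pi:X\to Y$ a quotient map and $\hat x\in X$. On the set of sections of $\pi$ whose image contains $\hat x$, define $\phi\sim\psi$ if there exist $L\ge1$ and $M\ge0$ such that $\phi$ is intrinsically $(L,M)$-quasi-isometric with respect to $\psi$ at the point $\hat x$ in strong sense. Then $\sim$ is an equivalence relation. (The equivalence class of a section $\psi$ is denoted by $[I_{\psi,\hat x}]$.)
   Context: A quotient map is a continuous, open and surjective map. A section of $\pi$ is a map $\phi:Y\to X$ with $\pi\circ\phi=\mathrm{id}_Y$. Given sections $\phi,\psi$ of $\pi$ and $\hat x\in X$, $\phi$ is intrinsically $(L,M)$-quasi-isometric with respect to $\psi$ at the point $\hat x$ in strong sense ($L\ge1$, $M\ge0$) if $\hat x\in\psi(Y)\cap\phi(Y)$ and, with $\hat y\in Y$ the point such that $\hat x=\phi(\hat y)=\psi(\hat y)$ (that is, $\hat y=\pi(\hat x)$), $$d(\phi(y),\psi(y))\le L\min\{d(\psi(\hat y),\psi(y)),\,d(\psi(\hat y),\phi(y))\}+M\quad\text{for all } y\in Y.$$ *)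

theory Defs
  imports "HOL-Analysis.Abstract_Topology"
begin

text \<open>Openness is part of the definition here, so this is stronger than
  the library's \<^const>\<open>quotient_map\<close>.\<close>

definition open_quotient_map :: "('a::topological_space \<Rightarrow> 'b::topological_space) \<Rightarrow> bool"
  where "open_quotient_map \<pi> \<longleftrightarrow>
    continuous_map euclidean euclidean \<pi> \<and> open_map euclidean euclidean \<pi> \<and> surj \<pi>"

text \<open>Sections are not required to be continuous.\<close>

definition is_section :: "('a \<Rightarrow> 'b) \<Rightarrow> ('b \<Rightarrow> 'a) \<Rightarrow> bool"
  where "is_section \<pi> \<phi> \<longleftrightarrow> \<pi> \<circ> \<phi> = id"

definition sections_through :: "('a \<Rightarrow> 'b) \<Rightarrow> 'a \<Rightarrow> ('b \<Rightarrow> 'a) set"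
  where "sections_through \<pi> x = {\<phi>. is_section \<pi> \<phi> \<and> x \<in> range \<phi>}"

text \<open>For sections with \<open>x\<close> in both images, the unique \<open>y0\<close> with
  \<open>x = \<phi> y0 = \<psi> y0\<close> is \<open>\<pi> x\<close>. The ranges \<open>L \<ge> 1\<close>, \<open>M \<ge> 0\<close> of the
  constants are imposed where they are quantified.\<close>

definition strong_intrinsic_qi ::
    "('a::metric_space \<Rightarrow> 'b) \<Rightarrow> real \<Rightarrow> real \<Rightarrow> ('b \<Rightarrow> 'a) \<Rightarrow> ('b \<Rightarrow> 'a) \<Rightarrow> 'a \<Rightarrow> bool"
  where "strong_intrinsic_qi \<pi> L M \<phi> \<psi> x \<longleftrightarrow>
    x \<in> range \<psi> \<inter> range \<phi> \<and>
    (let y0 = \<pi> x in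
      \<forall>y. dist (\<phi> y) (\<psi> y)
        \<le> L * min (dist (\<psi> y0) (\<psi> y)) (dist (\<psi> y0) (\<phi> y)) + M)"

definition strong_qi_rel ::
    "('a::metric_space \<Rightarrow> 'b) \<Rightarrow> 'a \<Rightarrow> (('b \<Rightarrow> 'a) \<times> ('b \<Rightarrow> 'a)) set"
  where "strong_qi_rel \<pi> x =
    {(\<phi>, \<psi>). \<phi> \<in> sections_through \<pi> x \<and> \<psi> \<in> sections_through \<pi> x \<and>
      (\<exists>L\<ge>1. \<exists>M\<ge>0. strong_intrinsic_qi \<pi> L M \<phi> \<psi> x)}"

end

theory Submission
  imports Defs
begin

text \<open>
  Every section whose image contains \<open>x\<close> takes the value \<open>x\<close> at \<open>\<pi> x\<close>. Hence the strong
  intrinsic inequality at \<open>x\<close> reads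
  \<open>dist (\<phi> y) (\<psi> y) \<le> L * min (dist x (\<phi> y)) (dist x (\<psi> y)) + M\<close> for all \<open>y\<close>,
  which is symmetric in \<open>\<phi>\<close> and \<open>\<psi>\<close>; reflexivity is trivial. For transitivity, with \<open>\<psi>\<close> the
  middle section, the distances \<open>dist x (\<phi> y)\<close> and \<open>dist x (\<psi> y)\<close> bound each other up to an
  affine change (\<open>dist_comparison_trans_le\<close>), so a bound in terms of \<open>dist x (\<psi> y)\<close> turns into
  one in terms of either outer distance.
\<close>

lemma section_through_at_basepoint:
  assumes "\<phi> \<in> sections_through \<pi> x"
  shows "\<phi> (\<pi> x) = x"
proof -
  obtain y where y: "x = \<phi> y" and "\<pi> \<circ> \<phi> = id"
    using assms by (auto simp: sections_through_def is_section_def)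
  then have "\<pi> x = y" by (metis comp_apply id_apply)
  with y show ?thesis by simp
qed

lemma strong_qi_rel_iff:
  "(\<phi>, \<psi>) \<in> strong_qi_rel \<pi> x \<longleftrightarrow>
    \<phi> \<in> sections_through \<pi> x \<and> \<psi> \<in> sections_through \<pi> x \<and>
    (\<exists>L\<ge>1. \<exists>M\<ge>0. \<forall>y. dist (\<phi> y) (\<psi> y) \<le> L * min (dist x (\<phi> y)) (dist x (\<psi> y)) + M)"
proof (cases "\<phi> \<in> sections_through \<pi> x \<and> \<psi> \<in> sections_through \<pi> x")
  case True
  then have "x \<in> range \<psi> \<inter> range \<phi>" by (simp add: sections_through_def)
  with True show ?thesis
    by (simp add: strong_qi_rel_def strong_intrinsic_qi_def Let_def
        section_through_at_basepoint min.commute)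
qed (auto simp: strong_qi_rel_def)

text \<open>The bound is in terms of the first point \<open>p\<close> of the chain \<open>p, q, r\<close>. Since the constants are invariant under exchanging \<open>(L, M)\<close> with \<open>(L', M')\<close>, applying the lemma to the
  reversed chain gives the same bound in terms of \<open>dist x r\<close>.\<close>

lemma dist_comparison_trans_le:
  fixes x p q r :: "'a::metric_space"
  assumes pq: "dist p q \<le> L * dist x p + M"
    and qr: "dist q r \<le> L' * dist x q + M'"
    and "0 \<le> L'" "0 \<le> L * M'"
  shows "dist p r \<le> (L + L' + L * L') * dist x p + (M + M' + L' * M + L * M')"
proof -
  have "dist x q \<le> dist x p + (L * dist x p + M)"
    using dist_triangle[of x q p] pq by linarith
  then have "L' * dist x q \<le> L' * (dist x p + (L * dist x p + M))"
    using \<open>0 \<le> L'\<close> by (rule mult_left_mono)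
  then have "dist p r \<le> (L * dist x p + M) + (L' * (dist x p + (L * dist x p + M)) + M')"
    using dist_triangle[of p r q] pq qr by linarith
  with \<open>0 \<le> L * M'\<close> show ?thesis by (simp add: algebra_simps)
qed

lemma trans_strong_qi_rel: "trans (strong_qi_rel \<pi> x)"
proof (rule transI)
  fix \<phi> \<psi> \<eta>
  assume "(\<phi>, \<psi>) \<in> strong_qi_rel \<pi> x" and "(\<psi>, \<eta>) \<in> strong_qi_rel \<pi> x"
  then obtain L M L' M' where
    sections: "\<phi> \<in> sections_through \<pi> x" "\<eta> \<in> sections_through \<pi> x" and
    const: "L \<ge> 1" "M \<ge> 0" "L' \<ge> 1" "M' \<ge> 0" and
    1: "\<And>y. dist (\<phi> y) (\<psi> y) \<le> L * min (dist x (\<phi> y)) (dist x (\<psi> y)) + M" and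
    2: "\<And>y. dist (\<psi> y) (\<eta> y) \<le> L' * min (dist x (\<psi> y)) (dist x (\<eta> y)) + M'"
    unfolding strong_qi_rel_iff by blast
  define K where "K = L + L' + L * L'"
  define N where "N = M + M' + L' * M + L * M'"
  have weaken: "c * min a b + d \<le> c * a + d" "c * min a b + d \<le> c * b + d"
    if "c \<ge> 1" for a b c d :: real
    using that by (simp_all add: mult_left_mono)
  have "dist (\<phi> y) (\<eta> y) \<le> K * min (dist x (\<phi> y)) (dist x (\<eta> y)) + N" for y
  proof -
    have "dist (\<phi> y) (\<eta> y) \<le> K * dist x (\<phi> y) + N"
      unfolding K_def N_def
      by (rule dist_comparison_trans_le[where q = "\<psi> y"])
        (use const 1[of y] 2[of y] weaken in \<open>auto intro: order_trans\<close>)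
    moreover have "dist (\<eta> y) (\<phi> y) \<le>
        (L' + L + L' * L) * dist x (\<eta> y) + (M' + M + L * M' + L' * M)"
      by (rule dist_comparison_trans_le[where q = "\<psi> y"])
        (use const 1[of y] 2[of y] weaken in \<open>auto simp: dist_commute intro: order_trans\<close>)
    then have "dist (\<phi> y) (\<eta> y) \<le> K * dist x (\<eta> y) + N"
      by (simp add: K_def N_def dist_commute algebra_simps)
    ultimately show ?thesis by (simp add: min_def)
  qed
  moreover have "K \<ge> 1" "N \<ge> 0"
    using const by (simp_all add: K_def N_def add_increasing2)
  ultimately show "(\<phi>, \<eta>) \<in> strong_qi_rel \<pi> x"
    using sections unfolding strong_qi_rel_iff by blast
qed

theorem theorem3p2:
  fixes \<pi> :: "'a::metric_space \<Rightarrow> 'b::topological_space" and x :: 'a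
  assumes "open_quotient_map \<pi>"
  shows "equiv (sections_through \<pi> x) (strong_qi_rel \<pi> x)"
proof (rule equivI)
  show "strong_qi_rel \<pi> x \<subseteq> sections_through \<pi> x \<times> sections_through \<pi> x"
    by (auto simp: strong_qi_rel_def)
  have "\<exists>L\<ge>1. \<exists>M\<ge>0. \<forall>y. dist (\<phi> y) (\<phi> y) \<le> L * min (dist x (\<phi> y)) (dist x (\<phi> y)) + M"
    for \<phi> :: "'b \<Rightarrow> 'a"
    by (rule exI[of _ 1], simp, rule exI[of _ 0], simp)
  then show "refl_on (sections_through \<pi> x) (strong_qi_rel \<pi> x)"
    unfolding refl_on_def strong_qi_rel_iff by blast
  show "sym (strong_qi_rel \<pi> x)"
    by (auto simp: sym_def strong_qi_rel_iff dist_commute min.commute)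
  show "trans (strong_qi_rel \<pi> x)"
    by (rule trans_strong_qi_rel)
qed

end
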